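(* Let $M$ be the monoid defined by the monoid presentation $\langle A\mid R\rangle$, and let $\rho$ be a finite index 2-sided congruence on $M$ with word graph $\Gamma=(V,E)$. Then $\rho$ is a group congruence if and only if $\Gamma$ is injective.
   Context: Functions are written to the right of their arguments. $A=\{a_0<\dots<a_{k-1}\}$ is a finite linearly ordered alphabet, $A^*$ is the free monoid on $A$ with identity the empty word $\varepsilon$, and $R\subseteq A^*\times A^*$. $R^{\#}$ is the least 2-sided congruence on $A^*$ containing $R$; the monoid defined by $\langle A\mid R\rangle$ is $M\cong A^*/R^{\#}$, and $\theta:A^*\to M$ is the natural surjective homomorphism with $\ker(\theta)=R^{\#}$. For $T\subseteq A^*\times A^*$ write $(T)\theta=\{((u)\theta,(v)\theta): (u,v)\in T\}$. The index of a congruence is its number of classes. A 2-sided congruence $\rho$ on $M$ is a group congruence if the quotient monoid $M/\rho$ is a group. A word graph over $A$ is a digraph $\Gamma=(V,E)$ with $E\subseteq V\times A\times V$; an edge $(\alpha,a,\beta)$ has source $\alpha$, label $a$, target $\beta$. It is complete (respectively deterministic) if for every node $\alpha$ and every $a\in A$ there is at least (respectively at most) one edge with source $\alpha$ and label $a$. It is injective if for every node $\beta$ and every $a\in A$ there is at most one edge with target $\beta$ and label $a$. A path is labelled by the product of the labels of its edges; the empty path at any node is labelled by $\varepsilon$. Write $\alpha\cdot u=\beta$ if $u\in A^*$ labels a path from $\alpha$ to $\beta$ (an $(\alpha,\beta)$-path), and $\alpha\cdot u=\bot$ (undefined) if $u$ labels no path with source $\alpha$. The path relation is $(\alpha)\pi_\Gamma=\{(u,v):\alpha\cdot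 u\neq\bot,\ \alpha\cdot u=\alpha\cdot v\}$. $\Gamma$ is compatible with $R$ if for all $(u,v)\in R$ and $\alpha\in V$, $\alpha\cdot u=\alpha\cdot v$ whenever both are $\neq\bot$. The short-lex order on $A^*$: $u<v$ if $|u|<|v|$, or $|u|=|v|$ and $u$ is strictly lexicographically smaller than $v$. For a node $\alpha$ reachable from $0$, $w_\alpha$ is the short-lex least word labelling a $(0,\alpha)$-path. A complete word graph $\Gamma=(V,E)$ is standard if $V=\{0,1,\ldots,|V|-1\}$, $\Gamma$ is deterministic, every node is reachable from $0$, and for all $\alpha,\beta\in V$: $\alpha<\beta$ if and only if $w_\alpha<w_\beta$. The word graph of a (finite index) right congruence $\rho$ on $M$ is the unique standard complete word graph $\Gamma$ over $A$ compatible with $R$ such that $\rho=((0)\pi_\Gamma)\theta$. *)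

theory Defs
  imports "HOL-Algebra.Group"
begin

section \<open>Congruences and quotients of monoids\<close>

definition two_sided_congruence :: "('m, 'z) monoid_scheme \<Rightarrow> ('m \<times> 'm) set \<Rightarrow> bool" where
  "two_sided_congruence M r \<longleftrightarrow>
     equiv (carrier M) r \<and>
     (\<forall>(x, y) \<in> r. \<forall>z \<in> carrier M.
        (z \<otimes>\<^bsub>M\<^esub> x, z \<otimes>\<^bsub>M\<^esub> y) \<in> r \<and> (x \<otimes>\<^bsub>M\<^esub> z, y \<otimes>\<^bsub>M\<^esub> z) \<in> r)"

definition generated_congruence ::
    "('m, 'z) monoid_scheme \<Rightarrow> ('m \<times> 'm) set \<Rightarrow> ('m \<times> 'm) set" where
  "generated_congruence M R = \<Inter>{r. two_sided_congruence M r \<and> R \<subseteq> r}"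

text \<open>For a two-sided congruence the union below ranges over copies of one and the same class;
  see \<open>quotient_monoid_mult\<close>.\<close>

definition quotient_monoid ::
    "('m, 'z) monoid_scheme \<Rightarrow> ('m \<times> 'm) set \<Rightarrow> 'm set monoid" where
  "quotient_monoid M r =
     \<lparr>carrier = carrier M // r,
      monoid.mult = (\<lambda>X Y. \<Union>x\<in>X. \<Union>y\<in>Y. r `` {x \<otimes>\<^bsub>M\<^esub> y}),
      one = r `` {\<one>\<^bsub>M\<^esub>}\<rparr>"

definition group_congruence :: "('m, 'z) monoid_scheme \<Rightarrow> ('m \<times> 'm) set \<Rightarrow> bool" where
  "group_congruence M r \<longleftrightarrow> two_sided_congruence M r \<and> group (quotient_monoid M r)"


section \<open>Monoid presentations\<close>

definition free_monoid :: "'a set \<Rightarrow> 'a list monoid" where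
  "free_monoid A = \<lparr>carrier = lists A, monoid.mult = (@), one = []\<rparr>"

text \<open>\<open>M\<close> is the monoid defined by the presentation with generators \<open>A\<close> and relations \<open>R\<close>,
  up to isomorphism; the isomorphism with the quotient of the free monoid is recorded by the
  surjective homomorphism \<open>\<theta>\<close>. The quotient itself is an instance
  (\<open>presents_quotient_monoid\<close>).\<close>

definition presents ::
    "'a set \<Rightarrow> ('a list \<times> 'a list) set \<Rightarrow> ('m, 'z) monoid_scheme \<Rightarrow> ('a list \<Rightarrow> 'm) \<Rightarrow> bool" where
  "presents A R M \<theta> \<longleftrightarrow>
     monoid M \<and>
     \<theta> \<in> hom (free_monoid A) M \<and> \<theta> [] = \<one>\<^bsub>M\<^esub> \<and>
     \<theta> ` lists A = carrier M \<and>
     {(u, v) \<in> lists A \<times> lists A. \<theta> u = \<theta> v} = generated_congruence (free_monoid A) R"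


section \<open>Word graphs\<close>

definition word_graph :: "'a set \<Rightarrow> 'v set \<Rightarrow> ('v \<times> 'a \<times> 'v) set \<Rightarrow> bool" where
  "word_graph A V E \<longleftrightarrow> E \<subseteq> V \<times> A \<times> V"

definition complete :: "'a set \<Rightarrow> 'v set \<Rightarrow> ('v \<times> 'a \<times> 'v) set \<Rightarrow> bool" where
  "complete A V E \<longleftrightarrow> (\<forall>\<alpha>\<in>V. \<forall>a\<in>A. \<exists>\<beta>. (\<alpha>, a, \<beta>) \<in> E)"

definition deterministic :: "'a set \<Rightarrow> 'v set \<Rightarrow> ('v \<times> 'a \<times> 'v) set \<Rightarrow> bool" where
  "deterministic A V E \<longleftrightarrow>
     (\<forall>\<alpha>\<in>V. \<forall>a\<in>A. \<forall>\<beta> \<gamma>. (\<alpha>, a, \<beta>) \<in> E \<longrightarrow> (\<alpha>, a, \<gamma>) \<in> E \<longrightarrow> \<beta> = \<gamma>)"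

definition injective :: "'a set \<Rightarrow> 'v set \<Rightarrow> ('v \<times> 'a \<times> 'v) set \<Rightarrow> bool" where
  "injective A V E \<longleftrightarrow>
     (\<forall>\<beta>\<in>V. \<forall>a\<in>A. \<forall>\<alpha> \<gamma>. (\<alpha>, a, \<beta>) \<in> E \<longrightarrow> (\<gamma>, a, \<beta>) \<in> E \<longrightarrow> \<alpha> = \<gamma>)"

inductive labels_path ::
    "'v set \<Rightarrow> ('v \<times> 'a \<times> 'v) set \<Rightarrow> 'v \<Rightarrow> 'a list \<Rightarrow> 'v \<Rightarrow> bool"
  for V E where
  empty: "\<alpha> \<in> V \<Longrightarrow> labels_path V E \<alpha> [] \<alpha>"
| edge: "(\<alpha>, a, \<beta>) \<in> E \<Longrightarrow> labels_path V E \<beta> u \<gamma> \<Longrightarrow> labels_path V E \<alpha> (a # u) \<gamma>"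

text \<open>The partial action \<open>\<alpha> \<cdot> u\<close>, with \<open>None\<close> for \<open>\<bottom>\<close>. It is meant for deterministic word graphs,
  in which the end of a path is determined by its source and its label.\<close>

definition act ::
    "'v set \<Rightarrow> ('v \<times> 'a \<times> 'v) set \<Rightarrow> 'v \<Rightarrow> 'a list \<Rightarrow> 'v option" where
  "act V E \<alpha> u =
     (if \<exists>\<beta>. labels_path V E \<alpha> u \<beta> then Some (THE \<beta>. labels_path V E \<alpha> u \<beta>) else None)"

definition path_relation ::
    "'v set \<Rightarrow> ('v \<times> 'a \<times> 'v) set \<Rightarrow> 'v \<Rightarrow> ('a list \<times> 'a list) set" where
  "path_relation V E \<alpha> = {(u, v). act V E \<alpha> u \<noteq> None \<and> act V E \<alpha> u = act V E \<alpha> v}"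

definition compatible ::
    "'v set \<Rightarrow> ('v \<times> 'a \<times> 'v) set \<Rightarrow> ('a list \<times> 'a list) set \<Rightarrow> bool" where
  "compatible V E R \<longleftrightarrow>
     (\<forall>(u, v)\<in>R. \<forall>\<alpha>\<in>V. act V E \<alpha> u \<noteq> None \<longrightarrow> act V E \<alpha> v \<noteq> None \<longrightarrow>
        act V E \<alpha> u = act V E \<alpha> v)"

definition shortlex :: "('a::linorder list \<times> 'a list) set" where
  "shortlex = lenlex {(a, b). a < b}"

definition least_word ::
    "nat set \<Rightarrow> (nat \<times> 'a::linorder \<times> nat) set \<Rightarrow> nat \<Rightarrow> 'a list" where
  "least_word V E \<alpha> =
     (THE w. labels_path V E 0 w \<alpha> \<and> (\<forall>u. labels_path V E 0 u \<alpha> \<longrightarrow> u \<noteq> w \<longrightarrow> (w, u) \<in> shortlex))"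

definition standard ::
    "'a::linorder set \<Rightarrow> nat set \<Rightarrow> (nat \<times> 'a \<times> nat) set \<Rightarrow> bool" where
  "standard A V E \<longleftrightarrow>
     finite V \<and> V = {..<card V} \<and>
     deterministic A V E \<and>
     (\<forall>\<alpha>\<in>V. \<exists>u. labels_path V E 0 u \<alpha>) \<and>
     (\<forall>\<alpha>\<in>V. \<forall>\<beta>\<in>V. \<alpha> < \<beta> \<longleftrightarrow> (least_word V E \<alpha>, least_word V E \<beta>) \<in> shortlex)"

definition word_graph_of_congruence ::
    "'a::linorder set \<Rightarrow> ('a list \<times> 'a list) set \<Rightarrow> ('a list \<Rightarrow> 'm) \<Rightarrow> ('m \<times> 'm) set \<Rightarrow>
     nat set \<Rightarrow> (nat \<times> 'a \<times> nat) set \<Rightarrow> bool" where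
  "word_graph_of_congruence A R \<theta> \<rho> V E \<longleftrightarrow>
     word_graph A V E \<and> complete A V E \<and> standard A V E \<and> compatible V E R \<and>
     \<rho> = map_prod \<theta> \<theta> ` path_relation V E 0"


section \<open>Well-definedness\<close>

lemma two_sided_congruence_mult:
  assumes "monoid M" "two_sided_congruence M r" "(x, x') \<in> r" "(y, y') \<in> r"
  shows "(x \<otimes>\<^bsub>M\<^esub> y, x' \<otimes>\<^bsub>M\<^esub> y') \<in> r"
proof -
  have e: "equiv (carrier M) r" using assms(2) by (simp add: two_sided_congruence_def)
  then have "y \<in> carrier M" "x' \<in> carrier M" using assms(3,4) by (auto simp: equiv_def)
  then have "(x \<otimes>\<^bsub>M\<^esub> y, x' \<otimes>\<^bsub>M\<^esub> y) \<in> r" "(x' \<otimes>\<^bsub>M\<^esub> y, x' \<otimes>\<^bsub>M\<^esub> y') \<in> r"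
    using assms(2-4) by (fastforce simp: two_sided_congruence_def)+
  then show ?thesis using e by (meson equivE transE)
qed

lemma quotient_monoid_mult:
  assumes "monoid M" "two_sided_congruence M r" "x \<in> carrier M" "y \<in> carrier M"
  shows "r `` {x} \<otimes>\<^bsub>quotient_monoid M r\<^esub> r `` {y} = r `` {x \<otimes>\<^bsub>M\<^esub> y}"
proof -
  have e: "equiv (carrier M) r" using assms(2) by (simp add: two_sided_congruence_def)
  have "r `` {x' \<otimes>\<^bsub>M\<^esub> y'} = r `` {x \<otimes>\<^bsub>M\<^esub> y}" if "x' \<in> r `` {x}" "y' \<in> r `` {y}" for x' y'
    using two_sided_congruence_mult[OF assms(1,2)] that equiv_class_eq[OF e] by blast
  moreover have "x \<in> r `` {x}" "y \<in> r `` {y}"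
    using equiv_class_self[OF e] assms(3,4) by simp_all
  ultimately have "(\<Union>x'\<in>r `` {x}. \<Union>y'\<in>r `` {y}. r `` {x' \<otimes>\<^bsub>M\<^esub> y'}) = r `` {x \<otimes>\<^bsub>M\<^esub> y}"
    by (intro SUP_eq_const) blast+
  then show ?thesis by (simp add: quotient_monoid_def)
qed

lemma monoid_quotient_monoid:
  assumes M: "monoid M" and r: "two_sided_congruence M r"
  shows "monoid (quotient_monoid M r)"
proof (rule monoidI)
  interpret monoid M by (rule M)
  note mult = quotient_monoid_mult[OF M r]
  let ?Q = "quotient_monoid M r"
  have car: "carrier ?Q = carrier M // r" and one: "\<one>\<^bsub>?Q\<^esub> = r `` {\<one>\<^bsub>M\<^esub>}"
    by (simp_all add: quotient_monoid_def)
  show "\<one>\<^bsub>?Q\<^esub> \<in> carrier ?Q" by (simp add: car one quotientI)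
  fix X Y Z
  assume "X \<in> carrier ?Q"
  then obtain x where x: "x \<in> carrier M" "X = r `` {x}" unfolding car by (auto elim: quotientE)
  show "\<one>\<^bsub>?Q\<^esub> \<otimes>\<^bsub>?Q\<^esub> X = X" "X \<otimes>\<^bsub>?Q\<^esub> \<one>\<^bsub>?Q\<^esub> = X" using x by (simp_all add: one mult)
  assume "Y \<in> carrier ?Q"
  then obtain y where y: "y \<in> carrier M" "Y = r `` {y}" unfolding car by (auto elim: quotientE)
  show "X \<otimes>\<^bsub>?Q\<^esub> Y \<in> carrier ?Q" using x y by (simp add: car mult quotientI)
  assume "Z \<in> carrier ?Q"
  then obtain z where z: "z \<in> carrier M" "Z = r `` {z}" unfolding car by (auto elim: quotientE)
  show "X \<otimes>\<^bsub>?Q\<^esub> Y \<otimes>\<^bsub>?Q\<^esub> Z = X \<otimes>\<^bsub>?Q\<^esub> (Y \<otimes>\<^bsub>?Q\<^esub> Z)"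
    using x y z by (simp add: mult m_assoc)
qed

lemma monoid_free_monoid: "monoid (free_monoid A)"
  by (rule monoidI) (auto simp: free_monoid_def)

lemma two_sided_congruence_generated:
  assumes M: "monoid M" and R: "R \<subseteq> carrier M \<times> carrier M"
  shows "two_sided_congruence M (generated_congruence M R)"
proof -
  interpret monoid M by (rule M)
  let ?C = "{r. two_sided_congruence M r \<and> R \<subseteq> r}"
  have all: "carrier M \<times> carrier M \<in> ?C"
    using R by (auto simp: two_sided_congruence_def equiv_def refl_on_def sym_def trans_def)
  have e: "r \<subseteq> carrier M \<times> carrier M" "refl_on (carrier M) r" "sym r" "trans r" if "r \<in> ?C" for r
    using that by (simp_all add: two_sided_congruence_def equiv_def)
  have m: "(z \<otimes>\<^bsub>M\<^esub> x, z \<otimes>\<^bsub>M\<^esub> y) \<in> r" "(x \<otimes>\<^bsub>M\<^esub> z, y \<otimes>\<^bsub>M\<^esub> z) \<in> r"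
    if "r \<in> ?C" "(x, y) \<in> r" "z \<in> carrier M" for r x y z
    using that unfolding two_sided_congruence_def by blast+
  have "equiv (carrier M) (\<Inter>?C)"
  proof (rule equivI)
    show "\<Inter>?C \<subseteq> carrier M \<times> carrier M" using all by blast
    show "refl_on (carrier M) (\<Inter>?C)" using e(2) unfolding refl_on_def by blast
    show "sym (\<Inter>?C)" using e(3) unfolding sym_def by blast
    show "trans (\<Inter>?C)"
      by (rule transI, rule InterI, rule transD[OF e(4)]) (assumption | erule (1) InterD)+
  qed
  moreover have "\<forall>(x, y)\<in>\<Inter>?C. \<forall>z\<in>carrier M.
      (z \<otimes>\<^bsub>M\<^esub> x, z \<otimes>\<^bsub>M\<^esub> y) \<in> \<Inter>?C \<and> (x \<otimes>\<^bsub>M\<^esub> z, y \<otimes>\<^bsub>M\<^esub> z) \<in> \<Inter>?C"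
    by (intro ballI, clarify, intro conjI; rule InterI; rule m; (assumption | erule InterD))
  ultimately show ?thesis
    unfolding generated_congruence_def two_sided_congruence_def[of M "\<Inter>?C"] by (rule conjI)
qed

lemma presents_quotient_monoid:
  assumes "R \<subseteq> lists A \<times> lists A"
  shows "presents A R (quotient_monoid (free_monoid A) (generated_congruence (free_monoid A) R))
           (\<lambda>w. generated_congruence (free_monoid A) R `` {w})"
proof -
  let ?F = "free_monoid A" and ?r = "generated_congruence (free_monoid A) R"
  have F: "carrier ?F = lists A" "monoid ?F" "\<one>\<^bsub>?F\<^esub> = []"
    using monoid_free_monoid by (auto simp: free_monoid_def)
  have c: "two_sided_congruence ?F ?r"
    using assms F by (intro two_sided_congruence_generated) auto
  then have e: "equiv (lists A) ?r" using F by (simp add: two_sided_congruence_def)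
  have "{(u, v) \<in> lists A \<times> lists A. ?r `` {u} = ?r `` {v}} = ?r"
    using equiv_class_eq_iff[OF e] by blast
  moreover have "(\<lambda>w. ?r `` {w}) \<in> hom ?F (quotient_monoid ?F ?r)"
  proof (rule homI)
    show "?r `` {u} \<in> carrier (quotient_monoid ?F ?r)" if "u \<in> carrier ?F" for u
      using that by (auto simp: quotient_monoid_def intro: quotientI)
  qed (use quotient_monoid_mult[OF F(2) c] in simp)
  moreover have "(\<lambda>w. ?r `` {w}) ` lists A = carrier (quotient_monoid ?F ?r)"
    using F by (auto simp: quotient_monoid_def quotient_def)
  moreover have "?r `` {[]} = \<one>\<^bsub>quotient_monoid ?F ?r\<^esub>"
    using F by (simp add: quotient_monoid_def)
  ultimately show ?thesis
    using monoid_quotient_monoid[OF F(2) c] by (simp add: presents_def)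
qed

end

theory Submission
  imports Defs
begin

text \<open>The quotient \<open>M / \<rho>\<close> is the set \<open>V\<close> of nodes in disguise: sending the class of \<open>\<theta> u\<close> to
  the end of the path from \<open>0\<close> labelled \<open>u\<close> is a bijection, and it turns right multiplication by
  \<open>\<theta> a\<close> into following the edge labelled \<open>a\<close>. The bijection is lemma
  \<open>rel_iff_same_endpoint\<close>. Its content is that \<open>\<rho>\<close> is given only as an image under \<open>\<theta>\<close>, so that
  the representatives provided by the path relation must be exchanged for arbitrary ones; this
  is possible because in a complete deterministic graph compatible with \<open>R\<close> words that are equal
  in the presented monoid act equally on every node (\<open>generated_congruence_acts_equally\<close>).

  Through this dictionary injectivity of the graph says that right multiplication by each
  generator can be cancelled in the quotient. A group is cancellative, which is one direction. Conversely, in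
  an injective graph every word acts as an injective self-map of \<open>V\<close>; as \<open>V\<close> is finite, the map is
  onto, so some node \<open>0 \<cdot> v\<close> is sent to \<open>0\<close> by \<open>u\<close>, that is, \<open>0 \<cdot> v u = 0 \<cdot> \<epsilon>\<close>. Hence the class of
  \<open>\<theta> v\<close> is a left inverse of that of \<open>\<theta> u\<close>, and a monoid with left inverses is a group.\<close>

section \<open>Paths in word graphs\<close>

lemma labels_path_closed:
  assumes "word_graph A V E" "labels_path V E \<alpha> u \<beta>"
  shows "\<alpha> \<in> V" "\<beta> \<in> V" "u \<in> lists A"
proof -
  have "\<alpha> \<in> V \<and> \<beta> \<in> V \<and> u \<in> lists A"
    using assms(2) by induction (use assms(1) in \<open>auto simp: word_graph_def\<close>)
  then show "\<alpha> \<in> V" "\<beta> \<in> V" "u \<in> lists A" by auto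
qed

lemma labels_path_Nil_iff: "labels_path V E \<alpha> [] \<beta> \<longleftrightarrow> \<alpha> \<in> V \<and> \<beta> = \<alpha>"
  by (auto elim: labels_path.cases intro: labels_path.empty)

lemma labels_path_Cons_iff:
  "labels_path V E \<alpha> (a # u) \<gamma> \<longleftrightarrow> (\<exists>\<beta>. (\<alpha>, a, \<beta>) \<in> E \<and> labels_path V E \<beta> u \<gamma>)"
  by (auto elim: labels_path.cases intro: labels_path.edge)

lemma labels_path_append_iff:
  assumes "word_graph A V E"
  shows "labels_path V E \<alpha> (u @ v) \<gamma> \<longleftrightarrow>
           (\<exists>\<beta>. labels_path V E \<alpha> u \<beta> \<and> labels_path V E \<beta> v \<gamma>)"
proof (induction u arbitrary: \<alpha>)
  case Nil
  show ?case using labels_path_closed(1)[OF assms] by (auto simp: labels_path_Nil_iff)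
next
  case (Cons a u)
  show ?case by (auto simp: labels_path_Cons_iff Cons.IH)
qed

lemma labels_path_singleton_iff:
  assumes "word_graph A V E"
  shows "labels_path V E \<alpha> [a] \<beta> \<longleftrightarrow> (\<alpha>, a, \<beta>) \<in> E"
  using assms by (auto simp: labels_path_Cons_iff labels_path_Nil_iff word_graph_def)

lemma labels_path_exists:
  assumes "word_graph A V E" "complete A V E" "\<alpha> \<in> V" "u \<in> lists A"
  shows "\<exists>\<beta>. labels_path V E \<alpha> u \<beta>"
  using assms(4,3)
proof (induction u arbitrary: \<alpha> rule: lists.induct)
  case Nil
  then show ?case by (auto simp: labels_path_Nil_iff)
next
  case (Cons a u)
  then obtain \<beta> where b: "(\<alpha>, a, \<beta>) \<in> E"
    using assms(2) unfolding complete_def by fastforce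
  then have "\<beta> \<in> V" using assms(1) by (auto simp: word_graph_def)
  then show ?case using Cons.IH b unfolding labels_path_Cons_iff by blast
qed

lemma labels_path_target_unique:
  assumes "word_graph A V E" "deterministic A V E"
    and "labels_path V E \<alpha> u \<beta>" "labels_path V E \<alpha> u \<gamma>"
  shows "\<beta> = \<gamma>"
  using assms(3,4)
proof (induction u arbitrary: \<alpha>)
  case Nil
  then show ?case by (simp add: labels_path_Nil_iff)
next
  case (Cons a u)
  then obtain \<delta> \<delta>' where d: "(\<alpha>, a, \<delta>) \<in> E" "labels_path V E \<delta> u \<beta>"
    "(\<alpha>, a, \<delta>') \<in> E" "labels_path V E \<delta>' u \<gamma>" by (auto simp: labels_path_Cons_iff)
  then have "\<delta> = \<delta>'" using assms(1,2) by (auto simp: word_graph_def deterministic_def)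
  then show ?case using Cons.IH d by blast
qed

lemma labels_path_source_unique:
  assumes "word_graph A V E" "injective A V E"
    and "labels_path V E \<alpha> u \<gamma>" "labels_path V E \<beta> u \<gamma>"
  shows "\<alpha> = \<beta>"
  using assms(3,4)
proof (induction u arbitrary: \<alpha> \<beta>)
  case Nil
  then show ?case by (simp add: labels_path_Nil_iff)
next
  case (Cons a u)
  then obtain \<delta> \<delta>' where d: "(\<alpha>, a, \<delta>) \<in> E" "labels_path V E \<delta> u \<gamma>"
    "(\<beta>, a, \<delta>') \<in> E" "labels_path V E \<delta>' u \<gamma>" by (auto simp: labels_path_Cons_iff)
  then have "\<delta> = \<delta>'" using Cons.IH by blast
  then show ?case using d assms(1,2) by (auto simp: word_graph_def injective_def)
qed

text \<open>In a finite graph uniqueness of sources upgrades to existence: following \<open>u\<close> is an injective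
  self-map of the finite set \<open>V\<close>, hence a surjective one.\<close>

lemma labels_path_source_exists:
  assumes wg: "word_graph A V E" "complete A V E"
    and inj: "injective A V E" and "finite V" "u \<in> lists A" "\<gamma> \<in> V"
  shows "\<exists>\<beta>. labels_path V E \<beta> u \<gamma>"
proof -
  obtain f where f: "labels_path V E \<alpha> u (f \<alpha>)" if "\<alpha> \<in> V" for \<alpha>
    using labels_path_exists[OF wg _ assms(5)] by metis
  have "inj_on f V"
  proof (rule inj_onI)
    fix \<alpha> \<beta> assume "\<alpha> \<in> V" "\<beta> \<in> V" "f \<alpha> = f \<beta>"
    then show "\<alpha> = \<beta>" using labels_path_source_unique[OF wg(1) inj, of \<alpha> u "f \<alpha>" \<beta>] f by metis
  qed
  moreover have "f ` V \<subseteq> V" using labels_path_closed(2)[OF wg(1)] f by blast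
  ultimately have "f ` V = V" using \<open>finite V\<close> by (simp add: endo_inj_surj)
  then obtain \<beta> where "\<beta> \<in> V" "\<gamma> = f \<beta>" using \<open>\<gamma> \<in> V\<close> by (metis imageE)
  then show ?thesis using f by blast
qed

section \<open>The path relation and the presented monoid\<close>

lemma act_eq_Some_iff:
  assumes "word_graph A V E" "deterministic A V E"
  shows "act V E \<alpha> u = Some \<beta> \<longleftrightarrow> labels_path V E \<alpha> u \<beta>"
proof -
  have "(THE \<gamma>. labels_path V E \<alpha> u \<gamma>) = \<delta>" if "labels_path V E \<alpha> u \<delta>" for \<delta>
    using that labels_path_target_unique[OF assms] by blast
  then show ?thesis by (auto simp: act_def)
qed

lemma path_relation_sym: "(u, v) \<in> path_relation V E \<alpha> \<Longrightarrow> (v, u) \<in> path_relation V E \<alpha>"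
  unfolding path_relation_def mem_Collect_eq case_prod_conv by metis

lemma path_relation_trans:
  "(u, v) \<in> path_relation V E \<alpha> \<Longrightarrow> (v, w) \<in> path_relation V E \<alpha> \<Longrightarrow>
     (u, w) \<in> path_relation V E \<alpha>"
  unfolding path_relation_def mem_Collect_eq case_prod_conv by metis

lemma path_relation_iff:
  assumes "word_graph A V E" "deterministic A V E"
  shows "(u, v) \<in> path_relation V E \<alpha> \<longleftrightarrow>
           (\<exists>\<beta>. labels_path V E \<alpha> u \<beta> \<and> labels_path V E \<alpha> v \<beta>)"
  unfolding path_relation_def act_eq_Some_iff[OF assms, symmetric] by auto

text \<open>To act equally on all nodes is a two-sided congruence of words, and compatibility with
  completeness says that it contains \<open>R\<close>. Quantifying over all nodes is what makes the relation
  stable under multiplication on the left; at a single node it is only a right congruence.\<close>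

lemma generated_congruence_acts_equally:
  assumes wg: "word_graph A V E" and comp: "complete A V E" and det: "deterministic A V E"
    and compat: "compatible V E R" and R: "R \<subseteq> lists A \<times> lists A"
    and uv: "(u, v) \<in> generated_congruence (free_monoid A) R" and "\<alpha> \<in> V"
  shows "(u, v) \<in> path_relation V E \<alpha>"
proof -
  note rel = path_relation_iff[OF wg det] and app = labels_path_append_iff[OF wg]
    and ex = labels_path_exists[OF wg comp] and uniq = labels_path_target_unique[OF wg det]
    and closed = labels_path_closed[OF wg]
  define K where "K = {(u, v) \<in> lists A \<times> lists A. \<forall>\<alpha>\<in>V. (u, v) \<in> path_relation V E \<alpha>}"
  have F: "carrier (free_monoid A) = lists A" "monoid.mult (free_monoid A) = (@)"
    by (simp_all add: free_monoid_def)
  have "equiv (lists A) K"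
  proof (rule equivI)
    show "K \<subseteq> lists A \<times> lists A" by (auto simp: K_def)
    show "refl_on (lists A) K" using ex unfolding refl_on_def K_def rel by blast
    show "sym K" by (auto simp: sym_def K_def intro: path_relation_sym)
    show "trans K" by (auto simp: trans_def K_def intro: path_relation_trans)
  qed
  moreover have "(z @ x, z @ y) \<in> K \<and> (x @ z, y @ z) \<in> K"
    if xy: "(x, y) \<in> K" and z: "z \<in> lists A" for x y z
  proof -
    have "(z @ x, z @ y) \<in> path_relation V E \<beta> \<and> (x @ z, y @ z) \<in> path_relation V E \<beta>"
      if b: "\<beta> \<in> V" for \<beta>
    proof
      obtain \<gamma> where g: "labels_path V E \<beta> z \<gamma>" using ex b z by blast
      moreover from g obtain \<delta> where "labels_path V E \<gamma> x \<delta>" "labels_path V E \<gamma> y \<delta>"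
        using xy closed(2)[OF g] by (auto simp: K_def rel)
      ultimately show "(z @ x, z @ y) \<in> path_relation V E \<beta>" by (auto simp: rel app)
      obtain \<gamma>' where g': "labels_path V E \<beta> x \<gamma>'" "labels_path V E \<beta> y \<gamma>'"
        using xy b by (auto simp: K_def rel)
      moreover from g' obtain \<delta>' where "labels_path V E \<gamma>' z \<delta>'" using ex closed(2) z by blast
      ultimately show "(x @ z, y @ z) \<in> path_relation V E \<beta>" by (auto simp: rel app)
    qed
    then show ?thesis using xy z by (auto simp: K_def)
  qed
  ultimately have "two_sided_congruence (free_monoid A) K"
    unfolding two_sided_congruence_def F by blast
  moreover have "R \<subseteq> K"
  proof
    fix p assume p: "p \<in> R"
    obtain x y where xy: "p = (x, y)" "x \<in> lists A" "y \<in> lists A" using p R by blast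
    have "(x, y) \<in> path_relation V E \<beta>" if b: "\<beta> \<in> V" for \<beta>
    proof -
      have "act V E \<beta> x \<noteq> None" "act V E \<beta> y \<noteq> None"
        using ex[OF b] xy by (simp_all add: act_def)
      then show ?thesis
        using compat p xy(1) b by (fastforce simp: compatible_def path_relation_def)
    qed
    then show "p \<in> K" using xy by (simp add: K_def)
  qed
  ultimately have "(u, v) \<in> K" using uv unfolding generated_congruence_def by blast
  then show ?thesis using \<open>\<alpha> \<in> V\<close> by (simp add: K_def)
qed

text \<open>Nodes correspond to classes of \<open>\<rho>\<close>. A pair in \<open>\<rho>\<close> comes from some words \<open>u'\<close>, \<open>v'\<close> that lead
  from \<open>0\<close> to the same node; if \<open>u\<close>, \<open>v\<close> represent the same elements, then \<open>u\<close> acts as \<open>u'\<close> and \<open>v\<close>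
  acts as \<open>v'\<close>.\<close>

lemma rel_iff_same_endpoint:
  assumes R: "R \<subseteq> lists A \<times> lists A" and pres: "presents A R M \<theta>"
    and graph: "word_graph_of_congruence A R \<theta> \<rho> V E"
    and u: "u \<in> lists A" and v: "v \<in> lists A"
  shows "(\<theta> u, \<theta> v) \<in> \<rho> \<longleftrightarrow> (u, v) \<in> path_relation V E 0"
proof
  have wg: "word_graph A V E" "complete A V E" "deterministic A V E" "compatible V E R"
    and rho: "\<rho> = map_prod \<theta> \<theta> ` path_relation V E 0"
    using graph by (auto simp: word_graph_of_congruence_def standard_def)
  show "(\<theta> u, \<theta> v) \<in> \<rho>" if "(u, v) \<in> path_relation V E 0"
    using that unfolding rho by force
  assume "(\<theta> u, \<theta> v) \<in> \<rho>"
  then obtain u' v' where uv': "\<theta> u = \<theta> u'" "\<theta> v = \<theta> v'" "(u', v') \<in> path_relation V E 0"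
    unfolding rho by auto
  then obtain \<beta> where "labels_path V E 0 u' \<beta>" "labels_path V E 0 v' \<beta>"
    by (auto simp: path_relation_iff[OF wg(1,3)])
  then have "0 \<in> V" "u' \<in> lists A" "v' \<in> lists A"
    using labels_path_closed[OF wg(1)] by blast+
  moreover from this have "(u, u') \<in> generated_congruence (free_monoid A) R"
    "(v, v') \<in> generated_congruence (free_monoid A) R"
    using pres uv' u v unfolding presents_def by blast+
  ultimately have "(u, u') \<in> path_relation V E 0" "(v, v') \<in> path_relation V E 0"
    using generated_congruence_acts_equally[OF wg R] by blast+
  then show "(u, v) \<in> path_relation V E 0" using uv'(3) path_relation_sym path_relation_trans by metis
qed

section \<open>Group congruences\<close>

theorem theorem5p5:
  fixes A :: "'a::linorder set"
    and R :: "('a list \<times> 'a list) set"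
    and M :: "('m, 'z) monoid_scheme"
    and \<theta> :: "'a list \<Rightarrow> 'm"
    and \<rho> :: "('m \<times> 'm) set"
    and V :: "nat set"
    and E :: "(nat \<times> 'a \<times> nat) set"
  assumes "finite A"
    and "R \<subseteq> lists A \<times> lists A"
    and "presents A R M \<theta>"
    and "two_sided_congruence M \<rho>"
    and "finite (carrier M // \<rho>)"
    and "word_graph_of_congruence A R \<theta> \<rho> V E"
  shows "group_congruence M \<rho> \<longleftrightarrow> injective A V E"
proof -
  let ?Q = "quotient_monoid M \<rho>"
  have wg: "word_graph A V E" "complete A V E" "deterministic A V E" and fin: "finite V"
    and reach: "\<And>\<alpha>. \<alpha> \<in> V \<Longrightarrow> \<exists>u. labels_path V E 0 u \<alpha>"
    using assms(6) by (auto simp: word_graph_of_congruence_def standard_def)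
  have M: "monoid M" and onto: "\<theta> ` lists A = carrier M" and one: "\<theta> [] = \<one>\<^bsub>M\<^esub>"
    and hom: "\<And>u v. u \<in> lists A \<Longrightarrow> v \<in> lists A \<Longrightarrow> \<theta> (u @ v) = \<theta> u \<otimes>\<^bsub>M\<^esub> \<theta> v"
    using assms(3) by (auto simp: presents_def hom_def free_monoid_def)
  have e: "equiv (carrier M) \<rho>" using assms(4) by (simp add: two_sided_congruence_def)
  have car: "\<theta> u \<in> carrier M" if "u \<in> lists A" for u using onto that by blast
  have class_eq: "\<rho> `` {\<theta> u} = \<rho> `` {\<theta> v} \<longleftrightarrow>
      (\<exists>\<beta>. labels_path V E 0 u \<beta> \<and> labels_path V E 0 v \<beta>)"
    if "u \<in> lists A" "v \<in> lists A" for u v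
    using rel_iff_same_endpoint[OF assms(2,3,6) that] eq_equiv_class_iff[OF e] car that
      path_relation_iff[OF wg(1,3)] by metis
  have class_append: "\<rho> `` {\<theta> (u @ v)} = \<rho> `` {\<theta> u} \<otimes>\<^bsub>?Q\<^esub> \<rho> `` {\<theta> v}"
    if "u \<in> lists A" "v \<in> lists A" for u v
    using quotient_monoid_mult[OF M assms(4)] car hom that by simp
  have Q: "carrier ?Q = carrier M // \<rho>" "\<one>\<^bsub>?Q\<^esub> = \<rho> `` {\<theta> []}"
    by (simp_all add: quotient_monoid_def one)
  have class_car: "\<rho> `` {\<theta> u} \<in> carrier ?Q" if "u \<in> lists A" for u
    using car that by (simp add: Q quotientI)
  \<comment> \<open>The class of the identity equals itself; read through \<open>class_eq\<close>, this is a path at \<open>0\<close>,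
      which excludes the empty graph.\<close>
  have zero: "0 \<in> V"
    using class_eq[of "[]" "[]"] by (auto simp: labels_path_Nil_iff)
  show ?thesis
  proof
    assume "group_congruence M \<rho>"
    then interpret group ?Q by (simp add: group_congruence_def)
    show "injective A V E"
      unfolding injective_def
    proof (intro ballI allI impI)
      fix \<gamma> a \<alpha> \<beta>
      assume a: "a \<in> A" and E: "(\<alpha>, a, \<gamma>) \<in> E" "(\<beta>, a, \<gamma>) \<in> E"
      then have "\<alpha> \<in> V" "\<beta> \<in> V" using wg(1) by (auto simp: word_graph_def)
      then obtain u v where uv: "labels_path V E 0 u \<alpha>" "labels_path V E 0 v \<beta>"
        using reach by blast
      then have l: "u \<in> lists A" "v \<in> lists A" "[a] \<in> lists A"
        using labels_path_closed(3)[OF wg(1)] a by auto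
      have "labels_path V E 0 (u @ [a]) \<gamma>" "labels_path V E 0 (v @ [a]) \<gamma>"
        using uv E by (auto simp: labels_path_append_iff[OF wg(1)]
            labels_path_singleton_iff[OF wg(1)])
      then have "\<rho> `` {\<theta> (u @ [a])} = \<rho> `` {\<theta> (v @ [a])}" using class_eq l by auto
      then have "\<rho> `` {\<theta> u} = \<rho> `` {\<theta> v}"
        using class_append l class_car right_cancel by simp
      then show "\<alpha> = \<beta>"
        using class_eq l uv labels_path_target_unique[OF wg(1,3)] by metis
    qed
  next
    assume inj: "injective A V E"
    interpret monoid ?Q by (rule monoid_quotient_monoid[OF M assms(4)])
    have "\<exists>Y\<in>carrier ?Q. Y \<otimes>\<^bsub>?Q\<^esub> X = \<one>\<^bsub>?Q\<^esub>" if "X \<in> carrier ?Q" for X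
    proof -
      obtain x where "x \<in> carrier M" "X = \<rho> `` {x}"
        using \<open>X \<in> carrier ?Q\<close> by (auto simp: Q(1) elim: quotientE)
      moreover from this obtain u where u: "u \<in> lists A" "x = \<theta> u"
        using onto by (metis imageE)
      ultimately have X: "X = \<rho> `` {\<theta> u}" by simp
      obtain \<beta> where b: "labels_path V E \<beta> u 0"
        using labels_path_source_exists[OF wg(1,2) inj fin u(1) zero] by blast
      then obtain v where v: "labels_path V E 0 v \<beta>"
        using reach labels_path_closed(1)[OF wg(1)] by blast
      then have vl: "v \<in> lists A" by (rule labels_path_closed(3)[OF wg(1)])
      have "labels_path V E 0 (v @ u) 0" "labels_path V E 0 [] 0"
        using b v zero by (auto simp: labels_path_append_iff[OF wg(1)] labels_path_Nil_iff)
      then have "\<rho> `` {\<theta> (v @ u)} = \<rho> `` {\<theta> []}" using class_eq[of "v @ u" "[]"] vl u(1) by auto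
      then have "\<rho> `` {\<theta> v} \<otimes>\<^bsub>?Q\<^esub> X = \<one>\<^bsub>?Q\<^esub>" using class_append[OF vl u(1)] X Q(2) by simp
      then show ?thesis using class_car vl by blast
    qed
    then have "group ?Q" by (intro groupI) (simp_all add: m_assoc)
    then show "group_congruence M \<rho>" using assms(4) by (simp add: group_congruence_def)
  qed
qed

end
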